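(* Let $\alpha\in\mathbb Q\cap(1,\infty)$ with regular continued fraction expansion $\alpha=[a_1,a_2,\ldots,a_n]$. (1) If $a_1=1$, then $\mathcal{S}_{\mathfrak{i}(\alpha)}(q)=\mathcal{S}^\vee_{\frac{(a_2+1)(\alpha-1)+\alpha-2}{\alpha-1}}(q)$. (2) If $a_1\ge 2$, then $\mathcal{S}_{\mathfrak{i}(\alpha)}(q)=\mathcal{S}^\vee_{\frac{a_1(\alpha-1)+\alpha-2}{\alpha-1}}(q)$.
   Context: A regular continued fraction $[a_1,\ldots,a_n]$ denotes $a_1+\cfrac{1}{a_2+\cfrac{1}{\ddots+\cfrac{1}{a_n}}}$ with $a_1\in\mathbb Z$, $a_2,\ldots,a_n$ positive integers. For an integer $c$, $[c]_q=\frac{1-q^c}{1-q}$. Every rational $\alpha>1$ has a unique negative continued fraction expansion $\alpha=c_1-\cfrac{1}{c_2-\cfrac{1}{\ddots-\cfrac{1}{c_l}}}$ with integers $c_j\ge 2$. Put $M^-_q(c)=\begin{pmatrix}[c]_q & -q^{c-1}\\ 1 & 0\end{pmatrix}$ and define $\mathcal{R}_\alpha(q),\mathcal{S}_\alpha(q)$ by $\begin{pmatrix}\mathcal{R}_\alpha(q)\\ \mathcal{S}_\alpha(q)\end{pmatrix}=M^-_q(c_1)\cdots M^-_q(c_l)\begin{pmatrix}1\\0\end{pmatrix}$; for rational $\alpha\le1$ they are defined recursively by $\mathcal{S}_\alpha=\mathcal{S}_{\alpha+1}$, $\mathcal{R}_\alpha=q^{-1}(\mathcal{R}_{\alpha+1}-\mathcal{S}_{\alpha+1})$.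 For a nonzero polynomial $f$, $f^\vee(q)=q^{\deg f}f(q^{-1})$. For $\alpha=\frac{x}{a}>1$ in lowest terms, $\mathfrak{i}(\alpha)=\frac{x}{x-a}$. *)

theory Defs
  imports "HOL-Analysis.Analysis" "HOL-Computational_Algebra.Polynomial_Factorial"
begin

fun regular_cf :: "int list \<Rightarrow> rat" where
  "regular_cf [] = 0"
| "regular_cf [a] = of_int a"
| "regular_cf (a # b # as) = of_int a + 1 / regular_cf (b # as)"

text \<open>
  The last partial quotient is allowed to be 1, so a rational number has two expansions
  \<open>[a\<^sub>1, \<dots>, a\<^sub>n]\<close>.
\<close>

definition is_regular_cf :: "int list \<Rightarrow> rat \<Rightarrow> bool" where
  "is_regular_cf as \<alpha> \<longleftrightarrow> as \<noteq> [] \<and> (\<forall>a \<in> set (tl as). a > 0) \<and> regular_cf as = \<alpha>"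

fun negative_cf :: "int list \<Rightarrow> rat" where
  "negative_cf [] = 0"
| "negative_cf [c] = of_int c"
| "negative_cf (c # d # cs) = of_int c - 1 / negative_cf (d # cs)"

definition is_negative_cf :: "int list \<Rightarrow> rat \<Rightarrow> bool" where
  "is_negative_cf cs \<alpha> \<longleftrightarrow> cs \<noteq> [] \<and> (\<forall>c \<in> set cs. c \<ge> 2) \<and> negative_cf cs = \<alpha>"

lemma negative_cf_gt_1:
  assumes "cs \<noteq> []" "\<forall>c \<in> set cs. c \<ge> 2"
  shows "negative_cf cs > 1"
  using assms
proof (induction cs rule: negative_cf.induct)
  case (2 c)
  then show ?case by simp
next
  case (3 c d cs)
  then have gt: "negative_cf (d # cs) > 1" by simp
  then have "1 / negative_cf (d # cs) < 1" by simp
  moreover have "(of_int c :: rat) \<ge> 2" using 3 by simp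
  ultimately show ?case by simp
qed simp

lemma negative_cf_Cons:
  "cs \<noteq> [] \<Longrightarrow> negative_cf (c # cs) = of_int c - 1 / negative_cf cs"
  by (cases cs) auto

lemma negative_cf_ceiling:
  assumes "cs \<noteq> []" "\<forall>c \<in> set cs. c \<ge> 2"
  shows "\<lceil>negative_cf (c # cs)\<rceil> = c" "negative_cf (c # cs) < of_int c"
proof -
  have "negative_cf cs > 1" using negative_cf_gt_1 assms by blast
  then have "0 < 1 / negative_cf cs" "1 / negative_cf cs < 1" by simp_all
  then show "\<lceil>negative_cf (c # cs)\<rceil> = c" "negative_cf (c # cs) < of_int c"
    using assms(1) by (simp_all add: negative_cf_Cons ceiling_eq_iff)
qed

lemma is_negative_cf_unique:
  "is_negative_cf cs \<alpha> \<Longrightarrow> is_negative_cf ds \<alpha> \<Longrightarrow> cs = ds"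
proof (induction cs arbitrary: ds \<alpha>)
  case Nil
  then show ?case by (simp add: is_negative_cf_def)
next
  case (Cons c cs)
  obtain d ds' where ds: "ds = d # ds'"
    using Cons.prems(2) by (cases ds) (auto simp: is_negative_cf_def)
  have eq: "negative_cf (c # cs) = negative_cf (d # ds')"
    and ge: "\<forall>c \<in> set cs. c \<ge> 2" "\<forall>c \<in> set ds'. c \<ge> 2"
    using Cons.prems by (auto simp: is_negative_cf_def ds)
  have ceil: "\<lceil>negative_cf (c # cs)\<rceil> = c" "\<lceil>negative_cf (d # ds')\<rceil> = d"
    using negative_cf_ceiling(1) ge by (cases "cs = []"; cases "ds' = []"; simp)+
  then have cd: "c = d" using eq by simp
  show ?case
  proof (cases "cs = [] \<or> ds' = []")
    case True
    then have "cs = [] \<and> ds' = []"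
      using negative_cf_ceiling(2)[of cs c] negative_cf_ceiling(2)[of ds' d] eq cd ge by fastforce
    then show ?thesis using cd ds by simp
  next
    case False
    then have "negative_cf cs = negative_cf ds'"
      using eq cd by (simp add: negative_cf_Cons)
    then show ?thesis
      using Cons.IH[of "negative_cf cs" ds'] False ge cd ds by (simp add: is_negative_cf_def)
  qed
qed

lemma is_negative_cf_exists:
  assumes "\<alpha> > 1"
  shows "\<exists>cs. is_negative_cf cs \<alpha>"
proof -
  have "\<exists>cs. is_negative_cf cs (of_int p / of_nat b)" if "int b < p" "b > 0" for b p
    using that
  proof (induction b arbitrary: p rule: less_induct)
    case (less b)
    define c where "c = \<lceil>of_int p / (of_nat b :: rat)\<rceil>"
    define r where "r = c * int b - p"
    have b0: "(of_nat b :: rat) > 0" using less.prems by simp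
    have "(of_int p :: rat) / of_nat b > 1"
      using less.prems b0 by (simp add: less_divide_eq)
    then have c2: "c \<ge> 2" unfolding c_def by linarith
    have "of_int p / (of_nat b :: rat) \<le> of_int c" "of_int c < of_int p / (of_nat b :: rat) + 1"
      unfolding c_def by linarith+
    then have "of_int p \<le> (of_int (c * int b) :: rat)" "(of_int (c * int b) :: rat) < of_int (p + int b)"
      using b0 by (simp_all add: field_simps)
    then have r: "0 \<le> r" "r < int b" unfolding r_def of_int_le_iff of_int_less_iff by simp_all
    show ?case
    proof (cases "r = 0")
      case True
      then have "(of_int p :: rat) = of_int c * of_nat b"
        unfolding r_def by (metis eq_iff_diff_eq_0 of_int_mult of_int_of_nat_eq)
      then have "is_negative_cf [c] (of_int p / of_nat b)"
        using c2 b0 by (simp add: is_negative_cf_def)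
      then show ?thesis by blast
    next
      case False
      obtain cs where cs: "is_negative_cf cs (of_int (int b) / of_nat (nat r))"
        using less.IH[of "nat r" "int b"] r False by auto
      have r0: "(of_int r :: rat) \<noteq> 0" using False by simp
      have "negative_cf cs = of_nat b / of_int r"
        using cs r by (simp add: is_negative_cf_def)
      then have "negative_cf (c # cs) = of_int c - of_int r / of_nat b"
        using cs by (simp add: negative_cf_Cons is_negative_cf_def)
      also have "\<dots> = of_int p / of_nat b"
        using b0 by (simp add: r_def field_simps)
      finally have "is_negative_cf (c # cs) (of_int p / of_nat b)"
        using cs c2 by (simp add: is_negative_cf_def)
      then show ?thesis by blast
    qed
  qed
  moreover obtain p b where pb: "quotient_of \<alpha> = (p, b)" by fastforce
  ultimately have *: "int (nat b) < p \<Longrightarrow> nat b > 0 \<Longrightarrow> ?thesis"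
    using quotient_of_div[OF pb] quotient_of_denom_pos[OF pb]
    by (metis nat_0_le of_int_of_nat_eq order_less_imp_le)
  have "b > 0" "\<alpha> = of_int p / of_int b"
    using quotient_of_denom_pos[OF pb] quotient_of_div[OF pb] by auto
  then show ?thesis using * assms by (simp add: less_divide_eq)
qed

text \<open>
  The quantities depending on \<open>q\<close> live in the field \<open>\<rat>(q)\<close>, realised as the fraction field of
  \<open>\<int>[q]\<close>, since for \<open>\<alpha> \<le> 0\<close> the numerator is only a Laurent polynomial.
\<close>

definition qvar :: "int poly fract" where
  "qvar = to_fract [:0, 1:]"

definition qint :: "int \<Rightarrow> int poly fract" where
  "qint c = (1 - qvar powi c) / (1 - qvar)"

definition Mneg :: "int \<Rightarrow> int poly fract ^ 2 ^ 2" where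
  "Mneg c = vector [vector [qint c, - (qvar powi (c - 1))],
                    vector [1, 0]]"

text \<open>The pair \<open>(\<R>\<^sub>\<alpha>(q), \<S>\<^sub>\<alpha>(q))\<close> as a column vector.\<close>

function qRS :: "rat \<Rightarrow> int poly fract ^ 2" where
  "\<alpha> > 1 \<Longrightarrow> qRS \<alpha> =
     foldr (\<lambda>c A. Mneg c ** A) (THE cs. is_negative_cf cs \<alpha>) (mat 1) *v vector [1, 0]"
| "\<alpha> \<le> 1 \<Longrightarrow> qRS \<alpha> =
     vector [inverse qvar * (qRS (\<alpha> + 1) $ 1 - qRS (\<alpha> + 1) $ 2), qRS (\<alpha> + 1) $ 2]"
  by (metis not_le) simp_all
termination
  by (relation "Wellfounded.measure (\<lambda>\<alpha>. nat \<lceil>2 - \<alpha>\<rceil>)") (auto, linarith+)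

definition qR :: "rat \<Rightarrow> int poly fract" where
  "qR \<alpha> = qRS \<alpha> $ 1"

text \<open>
  The second component is always a nonzero polynomial (proved below as \<open>to_fract_qS\<close> and
  \<open>qS_nonzero\<close>), and \<open>qS\<close> is that element of \<open>\<int>[q]\<close>. For \<open>f\<close> in \<open>\<int>[q]\<close>, the polynomial
  \<open>f\<^sup>\<or>(q) = q\<^bsup>deg f\<^esup> f(q\<^sup>-\<^sup>1)\<close> is \<open>reflect_poly f\<close>, cf. \<open>poly_reflect_poly_nz\<close>.
\<close>

definition qS :: "rat \<Rightarrow> int poly" where
  "qS \<alpha> = (THE p. to_fract p = qRS \<alpha> $ 2)"

lemma qvar_neq_1: "1 - qvar \<noteq> 0"
proof -
  have "to_fract (1 - [:0, 1:] :: int poly) \<noteq> 0"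
    unfolding to_fract_eq_0_iff by (simp add: one_pCons)
  then show ?thesis by (simp add: qvar_def)
qed

lemma to_fract_power: "to_fract (p ^ n) = to_fract p ^ n"
  by (induction n) simp_all

lemma to_fract_sum: "to_fract (\<Sum>i<n. f i) = (\<Sum>i<(n::nat). to_fract (f i))"
  by (induction n) simp_all

lemma qint_of_nat: "qint (int n) = to_fract (\<Sum>i<n. [:0, 1:] ^ i)"
proof -
  have "(1 - qvar) * (\<Sum>i<n. qvar ^ i) = 1 - qvar ^ n"
    by (rule one_diff_power_eq[symmetric])
  then show ?thesis
    using qvar_neq_1
    by (simp add: qint_def to_fract_sum to_fract_power flip: qvar_def) (simp add: field_simps)
qed

lemma Mneg_mult_vec:
  "Mneg c *v v = vector [qint c * v $ 1 - qvar powi (c - 1) * v $ 2, v $ 1]"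
  by (simp add: vec_eq_iff forall_2 matrix_vector_mult_def sum_2 Mneg_def)

lemma Mneg_prod_polynomial:
  assumes "\<forall>c \<in> set cs. c \<ge> 2"
  shows "\<exists>r s. foldr (\<lambda>c A. Mneg c ** A) cs (mat 1) *v vector [1, 0] =
           vector [to_fract r, to_fract s] \<and> poly r 1 > poly s 1 \<and> poly s 1 \<ge> 0
           \<and> (cs \<noteq> [] \<longrightarrow> poly s 1 > 0)"
  using assms
proof (induction cs)
  case Nil
  show ?case by (rule exI[of _ 1], rule exI[of _ 0]) simp
next
  case (Cons c cs)
  then obtain r s where rs:
    "foldr (\<lambda>c A. Mneg c ** A) cs (mat 1) *v vector [1, 0] = vector [to_fract r, to_fract s]"
    "poly r 1 > poly s 1" "poly s 1 \<ge> 0" by auto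
  define n where "n = nat c"
  have n: "c = int n" "n \<ge> 2" using Cons.prems by (auto simp: n_def)
  define r' where "r' = (\<Sum>i<n. [:0, 1:] ^ i) * r - [:0, 1:] ^ (n - 1) * s"
  have "foldr (\<lambda>c A. Mneg c ** A) (c # cs) (mat 1) *v vector [1, 0]
      = Mneg c *v vector [to_fract r, to_fract s]"
    by (simp add: rs(1) flip: matrix_vector_mul_assoc)
  also have "\<dots> = vector [to_fract r', to_fract r]"
  proof -
    have "int n - 1 = int (n - 1)" using n by simp
    then have "qvar powi (c - 1) = to_fract ([:0, 1:] ^ (n - 1))"
      by (simp only: n power_int_of_nat to_fract_power qvar_def)
    then show ?thesis by (simp add: Mneg_mult_vec r'_def n(1) qint_of_nat)
  qed
  finally have eq: "foldr (\<lambda>c A. Mneg c ** A) (c # cs) (mat 1) *v vector [1, 0]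
      = vector [to_fract r', to_fract r]" .
  have "poly r' 1 = int n * poly r 1 - poly s 1"
    by (simp add: r'_def poly_sum)
  moreover have "int n * poly r 1 \<ge> 2 * poly r 1"
    using n rs by (intro mult_right_mono) auto
  ultimately have "poly r' 1 > poly r 1" using rs by linarith
  then show ?case using eq rs by (intro exI[of _ r'] exI[of _ r]) auto
qed

lemma qRS_polynomial: "\<exists>p. p \<noteq> 0 \<and> qRS \<alpha> $ 2 = to_fract p"
proof (induction \<alpha> rule: qRS.induct)
  case (1 \<alpha>)
  have cs: "is_negative_cf (THE cs. is_negative_cf cs \<alpha>) \<alpha>"
    using is_negative_cf_exists[OF 1] is_negative_cf_unique by (metis theI)
  then obtain r s where "qRS \<alpha> = vector [to_fract r, to_fract s]" "poly s 1 > 0"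
    using Mneg_prod_polynomial[of "THE cs. is_negative_cf cs \<alpha>"] 1
    by (auto simp: is_negative_cf_def)
  then show ?case by (intro exI[of _ s]) auto
qed simp

lemma to_fract_qS: "to_fract (qS \<alpha>) = qRS \<alpha> $ 2"
proof -
  obtain p where p: "qRS \<alpha> $ 2 = to_fract p" using qRS_polynomial by blast
  show ?thesis unfolding qS_def p by simp
qed

lemma qS_nonzero: "qS \<alpha> \<noteq> 0"
  using qRS_polynomial[of \<alpha>] to_fract_qS[of \<alpha>] by auto

definition frak_i :: "rat \<Rightarrow> rat" where
  "frak_i \<alpha> = (let (x, a) = quotient_of \<alpha> in of_int x / of_int (x - a))"

end

theory Submission
  imports Defs
begin

text \<open>
  Since \<open>S\<close> is invariant under \<open>\<alpha> \<mapsto> \<alpha> + 1\<close>, both claims reduce to the single symmetry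
  \<open>S\<^bsub>-\<beta>\<^esub>\<^sup>\<or> = S\<^sub>\<beta>\<close> for \<open>\<beta> = 1 / (\<alpha> - 1)\<close>, and one may take \<open>0 < \<beta> < 1\<close>. With \<open>x = 1 / \<beta> > 1\<close> one
  has \<open>S\<^bsub>-1/x\<^esub> = R\<^sub>x\<close>, so it remains to compare \<open>R\<^sub>x\<close> with \<open>S\<^bsub>1/x\<^esub>\<close>. For every
  rational \<open>x > 0\<close> there is an \<open>n\<close> with \<open>R\<^bsub>1/x\<^esub>(q) = q\<^sup>n S\<^sub>x(q\<^sup>-\<^sup>1)\<close> and
  \<open>S\<^bsub>1/x\<^esub>(q) = q\<^sup>n R\<^sub>x(q\<^sup>-\<^sup>1)\<close>: this is symmetric under \<open>x \<mapsto> 1 / x\<close> and is preserved by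
  \<open>x \<mapsto> x + 1\<close> because \<open>1 / (x + 1) = 1 - 1 / (1 + 1 / x)\<close>. The constant coefficient of \<open>S\<close> being 1,
  the exponent \<open>n\<close> is the degree of \<open>R\<^sub>x\<close>.
\<close>

section \<open>Recursions for \<open>qRS\<close> and an induction principle to match them\<close>

declare qRS.simps [simp del]

lemma qvar_nonzero: "qvar \<noteq> 0"
  by (simp add: qvar_def)

lemma qint_add_1: "qint (c + 1) = 1 + qvar * qint c"
  using qvar_neq_1 by (simp add: qint_def power_int_add qvar_nonzero field_simps)

lemma qint_2: "qint 2 = 1 + qvar"
  using qint_add_1[of 1] qvar_neq_1 by (simp add: qint_def)

lemma qRS_negative_cf:
  assumes "is_negative_cf cs \<alpha>"
  shows "qRS \<alpha> = foldr (\<lambda>c A. Mneg c ** A) cs (mat 1) *v vector [1, 0]"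
proof -
  have "(THE cs. is_negative_cf cs \<alpha>) = cs"
    using assms is_negative_cf_unique by blast
  moreover have "\<alpha> > 1"
    using assms negative_cf_gt_1 by (auto simp: is_negative_cf_def)
  ultimately show ?thesis by (simp add: qRS.simps(1))
qed

text \<open>Prepending \<open>c\<close> to the negative continued fraction of \<alpha> puts
  \<open>Mneg c\<close> in front of the matrix product.\<close>

lemma qRS_minus_inverse:
  assumes "\<alpha> > 1" "c \<ge> 2"
  shows "qRS (of_int c - 1 / \<alpha>) = Mneg c *v qRS \<alpha>"
proof -
  obtain cs where cs: "is_negative_cf cs \<alpha>"
    using is_negative_cf_exists assms(1) by blast
  then have "is_negative_cf (c # cs) (of_int c - 1 / \<alpha>)"
    using assms(2) by (auto simp: is_negative_cf_def negative_cf_Cons)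
  then show ?thesis
    using cs by (simp add: qRS_negative_cf flip: matrix_vector_mul_assoc)
qed

text \<open>Below or at 1 this is the defining recursion solved for \<alpha> + 1. Above 1, the first
  entry \<open>c\<close> of the expansion becomes \<open>c + 1\<close>, and
  \<open>qint_add_1\<close> compares the two matrices.\<close>

lemma qRS_add_1: "qRS (\<alpha> + 1) = vector [qvar * qRS \<alpha> $ 1 + qRS \<alpha> $ 2, qRS \<alpha> $ 2]"
proof (cases "\<alpha> > 1")
  case True
  then obtain cs where cs: "is_negative_cf cs \<alpha>"
    using is_negative_cf_exists by blast
  then obtain c ds where c: "cs = c # ds"
    by (cases cs) (auto simp: is_negative_cf_def)
  have cs': "is_negative_cf ((c + 1) # ds) (\<alpha> + 1)"
    using cs by (cases ds) (auto simp: is_negative_cf_def c)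
  define v where "v = foldr (\<lambda>c A. Mneg c ** A) ds (mat 1) *v vector [1, 0]"
  have "qRS \<alpha> = Mneg c *v v" "qRS (\<alpha> + 1) = Mneg (c + 1) *v v"
    using qRS_negative_cf[OF cs] qRS_negative_cf[OF cs']
    by (simp_all add: c v_def flip: matrix_vector_mul_assoc)
  moreover have "qvar powi c = qvar * qvar powi (c - 1)"
    using power_int_add[of qvar 1 "c - 1"] qvar_nonzero by simp
  ultimately show ?thesis
    by (simp add: Mneg_mult_vec qint_add_1 vec_eq_iff forall_2 ring_distribs)
next
  case False
  then show ?thesis
    by (simp add: qRS.simps(2)[of \<alpha>] qvar_nonzero vec_eq_iff forall_2 flip: mult.assoc)
qed

lemma qS_eqI: "qRS \<alpha> $ 2 = to_fract p \<Longrightarrow> qS \<alpha> = p"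
  by (metis to_fract_qS to_fract_eq_iff)

lemma qS_add_1: "qS (\<alpha> + 1) = qS \<alpha>"
  by (rule qS_eqI) (simp add: qRS_add_1 to_fract_qS)

lemma qS_add_of_int: "qS (\<alpha> + of_int k) = qS \<alpha>"
proof (induction k rule: int_induct[where k = 0])
  case (step1 i)
  then show ?case using qS_add_1[of "\<alpha> + of_int i"] by (simp add: add.assoc)
next
  case (step2 i)
  then show ?case using qS_add_1[of "\<alpha> + of_int (i - 1)"] by (simp add: algebra_simps)
qed simp

lemma qS_of_int: "qS (of_int k) = 1"
proof -
  have "is_negative_cf [2] 2" by (simp add: is_negative_cf_def)
  then have "qRS 2 $ 2 = to_fract 1"
    by (simp add: qRS_negative_cf Mneg_mult_vec flip: matrix_vector_mul_assoc)
  then have "qS 2 = 1" by (rule qS_eqI)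
  then show ?thesis using qS_add_of_int[of 2 "k - 2"] by simp
qed

lemma qRS_1: "qRS 1 = vector [1, 1]"
proof -
  have "is_negative_cf [2] 2" by (simp add: is_negative_cf_def)
  then have "qRS 2 = vector [1 + qvar, 1]"
    by (simp add: qRS_negative_cf Mneg_mult_vec qint_2 flip: matrix_vector_mul_assoc)
  then show ?thesis by (simp add: qRS.simps(2)[of 1] qvar_nonzero)
qed

lemma qRS_inverse_add_1:
  assumes "x > 0"
  shows "qRS (1 / (x + 1)) =
    vector [qvar * qRS (1 / x) $ 1, qvar * qRS (1 / x) $ 1 + qRS (1 / x) $ 2]"
proof -
  \<comment> \<open>After the shift by 1 the argument has the form \<open>c - 1 / y\<close> with
    \<open>c = 2\<close> and \<open>y = 1 / x + 1 > 1\<close>.\<close>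
  have eq: "1 / (x + 1) + 1 = of_int 2 - 1 / (1 / x + 1)"
    using assms by (simp add: field_simps)
  have "qRS (1 / (x + 1) + 1) = Mneg 2 *v qRS (1 / x + 1)"
    unfolding eq by (rule qRS_minus_inverse) (use assms in auto)
  then have "qvar * qRS (1 / (x + 1)) $ 1 = qvar * (qvar * qRS (1 / x) $ 1)"
    and "qRS (1 / (x + 1)) $ 2 = qvar * qRS (1 / x) $ 1 + qRS (1 / x) $ 2"
    by (auto simp: qRS_add_1 Mneg_mult_vec qint_2 vec_eq_iff forall_2 ring_distribs)
  then show ?thesis
    by (simp add: vec_eq_iff forall_2 qvar_nonzero)
qed

text \<open>This is the subtractive Euclidean algorithm on numerator and denominator.\<close>

lemma positive_rat_induct [consumes 1, case_names one add_1 inverse]: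
  fixes x :: rat
  assumes "x > 0"
    and one: "P 1"
    and add_1: "\<And>x. x > 0 \<Longrightarrow> P x \<Longrightarrow> P (x + 1)"
    and inverse: "\<And>x. x > 0 \<Longrightarrow> P x \<Longrightarrow> P (1 / x)"
  shows "P x"
proof -
  have euclid: "P (of_nat a / of_nat b)" if "a > 0" "b > 0" for a b :: nat
    using that
  proof (induction "a + b" arbitrary: a b rule: less_induct)
    case less
    \<comment> \<open>Stated for \<open>c\<close>, \<open>d\<close> so that it serves
      \<open>a / b\<close> and, when \<open>a < b\<close>, the inverse \<open>b / a\<close>.\<close>
    have step: "P (of_nat c / of_nat d)" if "c > d" "d > 0" "c + d = a + b" for c d :: nat
    proof -
      have "P (of_nat (c - d) / of_nat d + 1)"
        using that less.hyps[of "c - d" d] by (intro add_1) auto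
      moreover have "of_nat (c - d) / of_nat d + 1 = (of_nat c / of_nat d :: rat)"
        using that by (simp add: of_nat_diff field_simps)
      ultimately show ?thesis by simp
    qed
    consider "a = b" | "a > b" | "a < b" by linarith
    then show ?case
    proof cases
      case 3
      then have "P (of_nat b / of_nat a)" using less.prems by (intro step) auto
      then show ?thesis using inverse[of "of_nat b / of_nat a"] less.prems by simp
    qed (use one step less.prems in auto)
  qed
  obtain p b where pb: "quotient_of x = (p, b)" by fastforce
  have b: "b > 0" "x = of_int p / of_int b"
    using quotient_of_denom_pos[OF pb] quotient_of_div[OF pb] by auto
  then have "p > 0" using assms(1) by (simp add: zero_less_divide_iff)
  then show ?thesis using euclid[of "nat p" "nat b"] b by simp
qed

section \<open>Reversal of polynomials and inversion of the argument\<close>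

text \<open>\<open>mirror n f g\<close> says that \<open>g(q) = q\<^sup>n f(q\<^sup>-\<^sup>1)\<close>.\<close>

definition mirror :: "nat \<Rightarrow> 'a::comm_semiring_1 poly \<Rightarrow> 'a poly \<Rightarrow> bool" where
  "mirror n f g \<longleftrightarrow> degree f \<le> n \<and> (\<forall>i. coeff g i = (if i \<le> n then coeff f (n - i) else 0))"

lemma mirror_sym:
  assumes "mirror n f g"
  shows "mirror n g f"
proof -
  have "degree g \<le> n" using assms by (intro degree_le) (auto simp: mirror_def)
  then show ?thesis using assms by (auto simp: mirror_def coeff_eq_0)
qed

lemma mirror_add: "mirror n f g \<Longrightarrow> mirror n f' g' \<Longrightarrow> mirror n (f + f') (g + g')"
  by (auto simp: mirror_def intro: degree_add_le)

lemma mirror_pCons_right: "mirror n f g \<Longrightarrow> mirror (Suc n) f (pCons 0 g)"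
  by (auto simp: mirror_def coeff_pCons coeff_eq_0 split: nat.split)

lemma mirror_pCons_left: "mirror n f g \<Longrightarrow> mirror (Suc n) (pCons 0 f) g"
  by (blast intro: mirror_sym mirror_pCons_right)

text \<open>The constant coefficient of \<open>g\<close> is the coefficient of \<open>f\<close> at
  \<open>n\<close>; being nonzero, it forces \<open>n\<close> to be the degree of
  \<open>f\<close>.\<close>

lemma mirror_reflect_poly:
  assumes "mirror n f g" "coeff g 0 \<noteq> 0"
  shows "g = reflect_poly f"
proof -
  have "degree f = n"
    using assms le_degree[of f n] by (auto simp: mirror_def)
  then show ?thesis
    using assms by (auto simp: poly_eq_iff mirror_def coeff_reflect_poly)
qed

lemma qvar_mult_to_fract: "qvar * to_fract p = to_fract (pCons 0 p)"
  by (simp add: qvar_def flip: to_fract_mult)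

lemma qRS_mirror:
  assumes "x > 0"
  shows "\<exists>n r s r' s'. qRS x = vector [to_fract r, to_fract s] \<and>
    qRS (1 / x) = vector [to_fract r', to_fract s'] \<and>
    mirror n r s' \<and> mirror n s r' \<and> coeff s 0 = 1 \<and> coeff s' 0 = 1"
  using assms
proof (induction x rule: positive_rat_induct)
  case one
  show ?case
    by (intro exI[of _ 0] exI[of _ 1]) (simp add: qRS_1 mirror_def)
next
  case (add_1 x)
  then obtain n r s r' s' where
    "qRS x = vector [to_fract r, to_fract s]" "qRS (1 / x) = vector [to_fract r', to_fract s']"
    and mirror: "mirror n r s'" "mirror n s r'" and "coeff s 0 = 1" "coeff s' 0 = 1"
    by blast
  \<comment> \<open>The summands pair crosswise: \<open>pCons 0 r\<close> with \<open>s'\<close>,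
    and \<open>s\<close> with \<open>pCons 0 r'\<close>.\<close>
  moreover have "mirror (Suc n) (pCons 0 r + s) (pCons 0 r' + s')"
    using mirror_add[OF mirror_pCons_left[OF mirror(1)] mirror_pCons_right[OF mirror(2)]]
    by (simp add: add.commute)
  ultimately show ?case
    using add_1.hyps mirror_pCons_right[OF mirror(2)]
    by (intro exI[of _ "Suc n"] exI[of _ "pCons 0 r + s"] exI[of _ s] exI[of _ "pCons 0 r'"]
        exI[of _ "pCons 0 r' + s'"])
      (simp add: qRS_add_1 qRS_inverse_add_1 qvar_mult_to_fract)
next
  case (inverse x)
  then obtain n r s r' s' where
    "qRS x = vector [to_fract r, to_fract s]" "qRS (1 / x) = vector [to_fract r', to_fract s']"
    "mirror n r s'" "mirror n s r'" "coeff s 0 = 1" "coeff s' 0 = 1"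
    by blast
  then show ?case
    by (intro exI[of _ n] exI[of _ r'] exI[of _ s'] exI[of _ r] exI[of _ s])
      (simp add: mirror_sym)
qed

section \<open>The symmetry under negation and its consequence\<close>

lemma qS_uminus: "qS \<beta> = reflect_poly (qS (- \<beta>))"
proof -
  define \<gamma> where "\<gamma> = frac \<beta>"
  have \<gamma>: "0 \<le> \<gamma>" "\<gamma> < 1" by (simp_all add: \<gamma>_def frac_lt_1)
  have shift: "qS \<beta> = qS \<gamma>" "qS (- \<beta>) = qS (- \<gamma>)"
    using qS_add_of_int[of \<gamma> "\<lfloor>\<beta>\<rfloor>"] qS_add_of_int[of "- \<gamma>" "- \<lfloor>\<beta>\<rfloor>"]
    by (simp_all add: \<gamma>_def frac_def)
  show ?thesis
  proof (cases "\<gamma> = 0")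
    case True
    then show ?thesis using shift qS_of_int[of 0] by simp
  next
    case False
    define x where "x = 1 / \<gamma>"
    have x: "x > 1" "\<gamma> = 1 / x" using \<gamma> False by (simp_all add: x_def)
    obtain n r s r' s' where rs: "qRS x = vector [to_fract r, to_fract s]"
      "qRS (1 / x) = vector [to_fract r', to_fract s']" "mirror n r s'" "coeff s' 0 = 1"
      using qRS_mirror[of x] x by auto
    \<comment> \<open>The lower row of \<open>Mneg 2\<close> is (1, 0), so the second component here
      is the first component at \<open>x\<close>; the shift by 2 meets the bound on \<open>c\<close>
      in \<open>qRS_minus_inverse\<close>.\<close>
    have "qRS (of_int 2 - 1 / x) $ 2 = to_fract r"
      using x by (subst qRS_minus_inverse) (simp_all add: Mneg_mult_vec rs)
    then have "qS (of_int 2 - 1 / x) = r" by (rule qS_eqI)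
    then have "qS (- \<gamma>) = r" using qS_add_of_int[of "- \<gamma>" 2] x by simp
    moreover have "qS \<gamma> = s'" using rs x by (intro qS_eqI) simp
    ultimately show ?thesis
      using mirror_reflect_poly[OF rs(3)] rs(4) shift by simp
  qed
qed

lemma frak_i_eq:
  assumes "\<alpha> > 1"
  shows "frak_i \<alpha> = 1 / (\<alpha> - 1) + 1"
proof -
  obtain x a where xa: "quotient_of \<alpha> = (x, a)" by fastforce
  have a: "a > 0" "\<alpha> = of_int x / of_int a"
    using quotient_of_denom_pos[OF xa] quotient_of_div[OF xa] by auto
  then have x: "(of_int x :: rat) > of_int a" using assms by (simp add: less_divide_eq)
  have "1 / (\<alpha> - 1) = of_int a / (of_int x - of_int a)"
    using a by (simp add: diff_divide_distrib flip: divide_divide_eq_right)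
      (simp add: field_simps)
  then show ?thesis using x by (simp add: frak_i_def xa add_divide_eq_iff field_simps)
qed

theorem theorem5p4:
  fixes \<alpha> :: rat and as :: "int list"
  assumes "\<alpha> > 1" and "is_regular_cf as \<alpha>"
  shows "(as ! 0 = 1 \<longrightarrow>
            qS (frak_i \<alpha>) =
            reflect_poly (qS (((of_int (as ! 1) + 1) * (\<alpha> - 1) + \<alpha> - 2) / (\<alpha> - 1)))) \<and>
         (as ! 0 \<ge> 2 \<longrightarrow>
            qS (frak_i \<alpha>) =
            reflect_poly (qS ((of_int (as ! 0) * (\<alpha> - 1) + \<alpha> - 2) / (\<alpha> - 1))))"
proof -
  \<comment> \<open>Here \<open>k\<close> enters only as an integer translation, under which
    \<open>qS\<close> is invariant. The claims are the instances \<open>k = as ! 1 + 1\<close> and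
    \<open>k = as ! 0\<close>.\<close>
  have "qS (frak_i \<alpha>) = reflect_poly (qS ((of_int k * (\<alpha> - 1) + \<alpha> - 2) / (\<alpha> - 1)))" for k
  proof -
    have "(of_int k * (\<alpha> - 1) + \<alpha> - 2) / (\<alpha> - 1) = - (1 / (\<alpha> - 1)) + of_int (k + 1)"
      using assms(1) by (simp add: field_simps)
    then show ?thesis
      using assms(1) qS_uminus[of "1 / (\<alpha> - 1)"] by (simp only: frak_i_eq qS_add_1 qS_add_of_int)
  qed
  from this[of "as ! 1 + 1"] this[of "as ! 0"] show ?thesis by simp
qed

end
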